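(* Let $X$ be a Banach space and let $(M,N)$ be a pair of closed subspaces of $X$, $M\neq\{\theta\}$, that belongs to the class of strictly singular operators. Then $\mathcal{SS}\lambda[M,N]=0$.
   Context: Conventions: $\mathbb{N}'$ is an infinite subset of $\mathbb{N}$, $\mathbb{N}''$ an infinite subset of $\mathbb{N}'$, $\mathbb{N}'''$ an infinite subset of $\mathbb{N}''$, etc.; limits are taken along these index sets. $\theta$ is the null element. A bounded operator $A:E\to F$ between Banach spaces is strictly singular, $A\in\mathcal{SS}(E,F)$, if for every $\varepsilon>0$ and every closed subspace $Z\subset E$ with $\dim Z=\infty$ there exists $z\in Z$ with $\|Az\|<\varepsilon\|z\|$. A pair $(M,N)$ of closed subspaces of $X$ belongs to the class of strictly singular operators if $Q_N\circ J_M\in\mathcal{SS}(M,X/N)$, where $J_M:M\to X$ is the inclusion and $Q_N:X\to X/N$ is the canonical surjection. Uniform $\lambda$-adjustment. Let $(M_n)_{\mathbb{N}'}$, $(P_n)_{\mathbb{N}'}$ be sequences of closed subspaces of a Banach space $X$ with $M_n\neq\{\theta\}$ for all $n$, and let $\lambda\ge 0$. $(M_n)_{\mathbb{N}'}$ is lower uniformly $\lambda$-adjusted with $(P_n)_{\mathbb{N}'}$ if for every $\eta>0$, every infinite $\mathbb{N}''\subset\mathbb{N}'$ and all unit vectors $x_n\in M_n$ ($n\in\mathbb{N}''$), there exist an infinite $\mathbb{N}'''\subset\mathbb{N}''$, vectors $y_n\in P_n$ ($n\in\mathbb{N}'''$) and a vector $z\in X$ such that $\varlimsup_{n\in\mathbb{N}'''}\|x_n-y_n-z\|\le\lambda+\eta$.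 $\lambda_{\mathbb{N}'}[M_n,P_n]$ is the infimum of all such $\lambda$. Strictly singular uniform $\lambda$-adjustment. For the same data, $\mathcal{SS}\lambda_{\mathbb{N}'}[M_n,P_n]$ is the infimum of all $\lambda\ge0$ such that: for every infinite $\mathbb{N}''\subset\mathbb{N}'$ and all closed subspaces $K_n\subset M_n$ with $\dim K_n=\infty$ ($n\in\mathbb{N}''$), there exist an infinite $\mathbb{N}'''\subset\mathbb{N}''$ and closed subspaces $L_n\subset K_n$ with $\dim L_n=\infty$ ($n\in\mathbb{N}'''$) such that $\lambda_{\mathbb{N}'''}[L_n,P_n]\le\lambda$. For single subspaces, $\mathcal{SS}\lambda[M,P]:=\mathcal{SS}\lambda_{\mathbb{N}'}[M_n,P_n]$ with the constant sequences $M_n=M$, $P_n=P$ for all $n\in\mathbb{N}'$. *)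

theory Defs
  imports "HOL-Analysis.Analysis"
begin

text \<open>
  Banach spaces over the real or the complex numbers. The class \<open>banach\<close> only knows real
  scalars, so the scalar multiplication by \<open>'k\<close> is a parameter: \<open>'k = real\<close> gives exactly
  the class \<open>banach\<close>, \<open>'k = complex\<close> gives complex Banach spaces, whose subspaces and
  dimensions are complex ones.
\<close>

locale banach_space_over = vector_space smul
  for smul :: "'k::{real_normed_field,euclidean_space} \<Rightarrow> 'a::banach \<Rightarrow> 'a" +
  assumes norm_scale: "norm (smul c x) = norm c * norm x"
    and scale_of_real: "smul (of_real r) x = r *\<^sub>R x"

lemma banach_space_over_real: "banach_space_over (scaleR :: real \<Rightarrow> 'a::banach \<Rightarrow> 'a)"
  by unfold_locales (simp_all add: scaleR_add_right scaleR_add_left)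

lemma banach_space_over_complex: "banach_space_over ((*) :: complex \<Rightarrow> complex \<Rightarrow> complex)"
  by unfold_locales (simp_all add: algebra_simps norm_mult scaleR_conv_of_real)

definition closed_subspace :: "('k::field \<Rightarrow> 'a::banach \<Rightarrow> 'a) \<Rightarrow> 'a set \<Rightarrow> bool" where
  "closed_subspace smul Z \<longleftrightarrow> module.subspace smul Z \<and> closed Z"

text \<open>The library's \<open>dim\<close> is a natural number and is \<open>0\<close> on infinite-dimensional subspaces.\<close>

definition infinite_dim :: "('k::field \<Rightarrow> 'a::banach \<Rightarrow> 'a) \<Rightarrow> 'a set \<Rightarrow> bool" where
  "infinite_dim smul Z \<longleftrightarrow> \<not> (\<exists>B. finite B \<and> Z \<subseteq> module.span smul B)"

text \<open>
  The elements of \<open>X/N\<close> are the cosets of \<open>N\<close>; the norm of a coset is the infimum of the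
  norms of its elements.
\<close>

definition quotient_map :: "'a::banach set \<Rightarrow> 'a \<Rightarrow> 'a set" where
  "quotient_map N x = (\<lambda>y. x + y) ` N"

definition quotient_norm :: "'a::banach set \<Rightarrow> real" where
  "quotient_norm C = Inf (norm ` C)"

text \<open>
  Strict singularity of a bounded operator \<open>A\<close> from the closed subspace \<open>E\<close> into a space with
  norm \<open>norm_F\<close>. Boundedness and linearity are not part of the predicate; the only
  operator used below, the restriction of \<open>quotient_map N\<close> to \<open>M\<close>, is always linear
  with bound \<open>1\<close>.
\<close>

definition strictly_singular ::
  "('k::field \<Rightarrow> 'a::banach \<Rightarrow> 'a) \<Rightarrow> 'a set \<Rightarrow> ('b \<Rightarrow> real) \<Rightarrow> ('a \<Rightarrow> 'b) \<Rightarrow> bool" where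
  "strictly_singular smul E norm_F A \<longleftrightarrow>
     (\<forall>\<epsilon>>0. \<forall>Z. closed_subspace smul Z \<and> Z \<subseteq> E \<and> infinite_dim smul Z \<longrightarrow>
        (\<exists>z\<in>Z. norm_F (A z) < \<epsilon> * norm z))"

definition strictly_singular_pair ::
  "('k::field \<Rightarrow> 'a::banach \<Rightarrow> 'a) \<Rightarrow> 'a set \<Rightarrow> 'a set \<Rightarrow> bool" where
  "strictly_singular_pair smul M N \<longleftrightarrow> strictly_singular smul M quotient_norm (quotient_map N)"

text \<open>
  Sequences indexed by an infinite \<open>I \<subseteq> \<nat>\<close> are total functions on \<open>nat\<close> of which only the values
  on \<open>I\<close> matter. The upper limit along \<open>I\<close> is taken with respect to the filter
  \<open>inf sequentially (principal I)\<close>, in \<open>ereal\<close>, since it may be infinite.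
\<close>

definition lower_uniformly_adjusted ::
  "nat set \<Rightarrow> (nat \<Rightarrow> 'a::banach set) \<Rightarrow> (nat \<Rightarrow> 'a set) \<Rightarrow> real \<Rightarrow> bool" where
  "lower_uniformly_adjusted I M P l \<longleftrightarrow>
     (\<forall>\<eta>>0. \<forall>J x. J \<subseteq> I \<and> infinite J \<and> (\<forall>n\<in>J. x n \<in> M n \<and> norm (x n) = 1) \<longrightarrow>
        (\<exists>K y z. K \<subseteq> J \<and> infinite K \<and> (\<forall>n\<in>K. y n \<in> P n) \<and>
           Limsup (inf sequentially (principal K)) (\<lambda>n. ereal (norm (x n - y n - z)))
             \<le> ereal (l + \<eta>)))"

text \<open>
  Both infima below range over sets of reals that are bounded below by \<open>0\<close> and, for subspaces,
  contain \<open>1\<close>, so that \<open>Inf\<close> on \<open>real\<close> is the true infimum.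
\<close>

definition uniform_adjustment ::
  "nat set \<Rightarrow> (nat \<Rightarrow> 'a::banach set) \<Rightarrow> (nat \<Rightarrow> 'a set) \<Rightarrow> real" where
  "uniform_adjustment I M P = Inf {l. 0 \<le> l \<and> lower_uniformly_adjusted I M P l}"

definition SS_uniform_adjustment ::
  "('k::field \<Rightarrow> 'a::banach \<Rightarrow> 'a) \<Rightarrow> nat set \<Rightarrow> (nat \<Rightarrow> 'a set) \<Rightarrow> (nat \<Rightarrow> 'a set) \<Rightarrow> real" where
  "SS_uniform_adjustment smul I M P = Inf {l. 0 \<le> l \<and>
     (\<forall>J K. J \<subseteq> I \<and> infinite J \<and>
        (\<forall>n\<in>J. closed_subspace smul (K n) \<and> K n \<subseteq> M n \<and> infinite_dim smul (K n)) \<longrightarrow>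
        (\<exists>H L. H \<subseteq> J \<and> infinite H \<and>
           (\<forall>n\<in>H. closed_subspace smul (L n) \<and> L n \<subseteq> K n \<and> infinite_dim smul (L n)) \<and>
           uniform_adjustment H L P \<le> l))}"

end

theory Submission
  imports Defs
begin

text \<open>
  Kato's argument. Hahn--Banach functionals give unit vectors \<open>z n\<close> in a prescribed
  infinite-dimensional subspace, as close to \<open>N\<close> as desired, such that \<open>z j\<close> is annihilated by the
  functional norming \<open>z i\<close> whenever \<open>i < j\<close>. The \<open>n\<close>-th coefficient of a combination \<open>x\<close> of the \<open>z i\<close>
  is then at most \<open>2 ^ n * norm x\<close>, so every vector of the closed span lies within \<open>\<epsilon> * norm x\<close> of \<open>N\<close>.
  Applying this to \<open>K n\<close> with \<open>\<epsilon> = 1 / Suc n\<close> yields the adjustment with \<open>z = 0\<close>.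
\<close>

subsection \<open>Linear functionals below sublinear ones\<close>

text \<open>Homogeneity is demanded only as an inequality, which is all that must be checked for the
  functionals built below; equality for \<open>t > 0\<close> follows by scaling back with
  \<open>inverse t\<close>.\<close>

definition sublinear :: "('a::real_vector \<Rightarrow> real) \<Rightarrow> bool" where
  "sublinear p \<longleftrightarrow> (\<forall>x y. p (x + y) \<le> p x + p y) \<and> (\<forall>t\<ge>0. \<forall>x. p (t *\<^sub>R x) \<le> t * p x)"

lemma sublinear_add: "sublinear p \<Longrightarrow> p (x + y) \<le> p x + p y"
  by (simp add: sublinear_def)

lemma sublinear_scaleR_le: "sublinear p \<Longrightarrow> 0 \<le> t \<Longrightarrow> p (t *\<^sub>R x) \<le> t * p x"
  by (simp add: sublinear_def)

lemma sublinear_zero: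
  assumes "sublinear p"
  shows "p 0 = 0"
  using sublinear_add[OF assms, of 0 0] sublinear_scaleR_le[OF assms, of 0 0] by simp

lemma sublinear_scaleR:
  assumes "sublinear p" "0 \<le> t"
  shows "p (t *\<^sub>R x) = t * p x"
proof (cases "t = 0")
  case True
  then show ?thesis by (simp add: sublinear_zero[OF assms(1)])
next
  case False
  with assms(2) have t: "t > 0" by simp
  have "p x \<le> p (t *\<^sub>R x) / t"
    using sublinear_scaleR_le[OF assms(1), of "inverse t" "t *\<^sub>R x"] t
    by (simp add: divide_inverse_commute)
  then have "t * p x \<le> p (t *\<^sub>R x)"
    using t by (simp add: field_simps)
  then show ?thesis
    using sublinear_scaleR_le[OF assms, of x] by simp
qed

lemma sublinear_ge_minus: "sublinear p \<Longrightarrow> - p (- x) \<le> p x"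
  using sublinear_add[of p x "- x"] sublinear_zero[of p] by simp

section \<open>Infima of sublinear functionals\<close>

lemma le_cINF_add:
  fixes c :: real
  assumes "A \<noteq> {}" "B \<noteq> {}" and le: "\<And>a b. a \<in> A \<Longrightarrow> b \<in> B \<Longrightarrow> c \<le> f a + g b"
  shows "c \<le> (INF a\<in>A. f a) + (INF b\<in>B. g b)"
proof -
  have "c - (INF a\<in>A. f a) \<le> g b" if "b \<in> B" for b
  proof -
    have "c - g b \<le> (INF a\<in>A. f a)"
      by (rule cINF_greatest[OF \<open>A \<noteq> {}\<close>]) (use le that in \<open>force simp: algebra_simps\<close>)
    then show ?thesis by simp
  qed
  then have "c - (INF a\<in>A. f a) \<le> (INF b\<in>B. g b)"
    by (intro cINF_greatest[OF \<open>B \<noteq> {}\<close>])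
  then show ?thesis by simp
qed

text \<open>The largest sublinear functional below \<open>p\<close> with value at most \<open>- p y\<close> at \<open>- y\<close>.\<close>

definition lower_along :: "'a::real_vector \<Rightarrow> ('a \<Rightarrow> real) \<Rightarrow> 'a \<Rightarrow> real" where
  "lower_along y p x = (INF t\<in>{0..}. p (x + t *\<^sub>R y) - t * p y)"

text \<open>A real infimum bounds its members only if the family is bounded below. Subadditivity
  applied to \<open>(x + s *\<^sub>R y) + (- x)\<close> supplies the bound \<open>- p (- x)\<close>,
  uniform in \<open>s\<close>.\<close>

lemma lower_along_le:
  assumes "sublinear p" "0 \<le> t"
  shows "lower_along y p x \<le> p (x + t *\<^sub>R y) - t * p y"
  unfolding lower_along_def
proof (rule cINF_lower)
  have "- p (- x) \<le> p (x + s *\<^sub>R y) - s * p y" if "0 \<le> s" for s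
    using sublinear_add[OF assms(1), of "x + s *\<^sub>R y" "- x"] sublinear_scaleR[OF assms(1) that, of y]
    by simp
  then show "bdd_below ((\<lambda>t. p (x + t *\<^sub>R y) - t * p y) ` {0..})"
    by (intro bdd_belowI2) auto
qed (use assms in auto)

lemma sublinear_lower_along:
  assumes p: "sublinear p"
  shows "sublinear (lower_along y p)"
  unfolding sublinear_def
proof (intro conjI allI impI)
  fix u v
  \<comment> \<open>The parameters add up: \<open>s + t\<close> is a competitor in the infimum at
    \<open>u + v\<close>.\<close>
  have "lower_along y p (u + v) \<le> (p (u + s *\<^sub>R y) - s * p y) + (p (v + t *\<^sub>R y) - t * p y)"
    if "s \<in> {0..}" "t \<in> {0..}" for s t
    using lower_along_le[OF p, of "s + t" y "u + v"]
      sublinear_add[OF p, of "u + s *\<^sub>R y" "v + t *\<^sub>R y"] that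
    by (simp add: algebra_simps)
  then show "lower_along y p (u + v) \<le> lower_along y p u + lower_along y p v"
    unfolding lower_along_def[of y p u] lower_along_def[of y p v] by (intro le_cINF_add) auto
next
  fix r :: real and u
  assume "0 \<le> r"
  show "lower_along y p (r *\<^sub>R u) \<le> r * lower_along y p u"
  proof (cases "r = 0")
    case True
    then show ?thesis
      using lower_along_le[OF p, of 0 y 0] sublinear_zero[OF p] by simp
  next
    case False
    with \<open>0 \<le> r\<close> have r: "r > 0" by simp
    \<comment> \<open>Scaling the argument by \<open>r\<close> scales the parameter too:
      \<open>t\<close> at \<open>u\<close> corresponds to \<open>r * t\<close> at
      \<open>r *\<^sub>R u\<close>.\<close>
    have "lower_along y p (r *\<^sub>R u) / r \<le> p (u + t *\<^sub>R y) - t * p y" if "0 \<le> t" for t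
    proof -
      have "lower_along y p (r *\<^sub>R u) \<le> p (r *\<^sub>R (u + t *\<^sub>R y)) - r * t * p y"
        using lower_along_le[OF p, of "r * t" y "r *\<^sub>R u"] r that by (simp add: algebra_simps)
      then show ?thesis
        unfolding sublinear_scaleR[OF p \<open>0 \<le> r\<close>] using r by (simp add: field_simps)
    qed
    then have "lower_along y p (r *\<^sub>R u) / r \<le> lower_along y p u"
      unfolding lower_along_def[of y p u] by (intro cINF_greatest) auto
    then show ?thesis using r by (simp add: field_simps)
  qed
qed

text \<open>Infima of sublinear functionals need not be subadditive in general. In a chain, any
  \<open>p\<close> and \<open>q\<close> have a member below both, and its subadditivity bounds the
  infimum at \<open>x + y\<close> by \<open>p x + q y\<close>.\<close>

lemma sublinear_cINF_chain:
  assumes "C \<noteq> {}" and sub: "\<And>p. p \<in> C \<Longrightarrow> sublinear p"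
    and chain: "\<And>p q. p \<in> C \<Longrightarrow> q \<in> C \<Longrightarrow> p \<le> q \<or> q \<le> p"
    and bdd: "\<And>x. bdd_below ((\<lambda>p. p x) ` C)"
  shows "sublinear (\<lambda>x. INF p\<in>C. p x)"
  unfolding sublinear_def
proof (intro conjI allI impI)
  fix x y
  have "(INF r\<in>C. r (x + y)) \<le> p x + q y" if pq: "p \<in> C" "q \<in> C" for p q
  proof -
    obtain r where r: "r \<in> C" "r \<le> p" "r \<le> q"
      using chain[OF pq] pq by blast
    have "(INF r\<in>C. r (x + y)) \<le> r (x + y)"
      using bdd r(1) by (rule cINF_lower)
    also have "\<dots> \<le> r x + r y"
      using sub[OF r(1)] by (rule sublinear_add)
    also have "\<dots> \<le> p x + q y"
      using r by (intro add_mono) (auto simp: le_fun_def)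
    finally show ?thesis .
  qed
  then show "(INF p\<in>C. p (x + y)) \<le> (INF p\<in>C. p x) + (INF p\<in>C. p y)"
    using \<open>C \<noteq> {}\<close> by (intro le_cINF_add) auto
next
  fix t :: real and x
  assume t: "0 \<le> t"
  have le: "(INF r\<in>C. r (t *\<^sub>R x)) \<le> t * p x" if "p \<in> C" for p
    using cINF_lower[OF bdd that, of "t *\<^sub>R x"] sublinear_scaleR[OF sub[OF that] t, of x] by simp
  show "(INF p\<in>C. p (t *\<^sub>R x)) \<le> t * (INF p\<in>C. p x)"
  proof (cases "t = 0")
    case True
    then show ?thesis using le \<open>C \<noteq> {}\<close> by auto
  next
    case False
    with t have t': "t > 0" by simp
    have "(INF r\<in>C. r (t *\<^sub>R x)) / t \<le> (INF p\<in>C. p x)"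
      using le t' \<open>C \<noteq> {}\<close> by (intro cINF_greatest) (auto simp: field_simps)
    then show ?thesis using t' by (simp add: field_simps)
  qed
qed

text \<open>A minimal sublinear functional is fixed by every \<open>lower_along y\<close>, which makes it additive.\<close>

lemma ex_linear_below_sublinear:
  fixes p :: "'a::real_vector \<Rightarrow> real"
  assumes p: "sublinear p"
  shows "\<exists>f. linear f \<and> f \<le> p"
proof -
  define A where "A = {q. sublinear q \<and> q \<le> p}"
  have "\<exists>m\<in>A. \<forall>a\<in>A. a \<le> m \<longrightarrow> a = m"
  proof (rule predicate_Zorn)
    \<comment> \<open>The order is reversed, so that maximality in Zorn's lemma means pointwise
      minimality.\<close>
    show "partial_order_on A (relation_of (\<lambda>q r. r \<le> q) A)"
      by (rule partial_order_on_relation_ofI) auto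
    fix C
    assume C: "C \<in> Chains (relation_of (\<lambda>q r. r \<le> q) A)"
    have CA: "C \<subseteq> A" using C by (auto simp: Chains_def relation_of_def)
    show "\<exists>u\<in>A. \<forall>a\<in>C. u \<le> a"
    proof (cases "C = {}")
      case True
      then show ?thesis using p by (auto simp: A_def)
    next
      case False
      then obtain q0 where q0: "q0 \<in> C" by blast
      \<comment> \<open>Membership in \<open>A\<close> gives one bound for all \<open>q\<close> at
        once: \<open>- p (- x) \<le> - q (- x) \<le> q x\<close>.\<close>
      have bdd: "bdd_below ((\<lambda>q. q x) ` C)" for x
      proof (rule bdd_belowI2)
        fix q assume "q \<in> C"
        then have "sublinear q" "q (- x) \<le> p (- x)" using CA by (auto simp: A_def le_fun_def)
        then show "- p (- x) \<le> q x" using sublinear_ge_minus[of q x] by simp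
      qed
      have lower: "(\<lambda>x. INF q\<in>C. q x) \<le> r" if "r \<in> C" for r
        unfolding le_fun_def using cINF_lower[OF bdd that] by blast
      have "sublinear (\<lambda>x. INF q\<in>C. q x)"
        using C CA bdd False
        by (intro sublinear_cINF_chain) (auto simp: A_def Chains_def relation_of_def)
      moreover have "(\<lambda>x. INF q\<in>C. q x) \<le> p"
        using lower[OF q0] q0 CA by (auto simp: A_def)
      ultimately show ?thesis using lower by (auto simp: A_def)
    qed
  qed
  then obtain m where "m \<in> A" and min_A: "\<And>q. q \<in> A \<Longrightarrow> q \<le> m \<Longrightarrow> q = m"
    by blast
  then have m: "sublinear m" "m \<le> p"
    by (auto simp: A_def)
  have min: "q = m" if "sublinear q" "q \<le> m" for q
    using that order_trans[OF that(2) m(2)] by (intro min_A) (auto simp: A_def)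
  have eq: "lower_along y m = m" for y
    using sublinear_lower_along[OF m(1)] lower_along_le[OF m(1), of 0]
    by (intro min) (auto simp: le_fun_def)
  \<comment> \<open>The parameter \<open>1\<close> in \<open>lower_along y m x = m x\<close> yields
    \<open>m x \<le> m (x + y) - m y\<close>, the converse of subadditivity.\<close>
  have add: "m (x + y) = m x + m y" for x y
    using lower_along_le[OF m(1), of 1 y x] eq[of y] sublinear_add[OF m(1), of x y] by simp
  have neg: "m (- x) = - m x" for x
    using add[of x "- x"] sublinear_zero[OF m(1)] by simp
  have "m (r *\<^sub>R x) = r * m x" for r x
  proof (cases "0 \<le> r")
    case True
    then show ?thesis by (rule sublinear_scaleR[OF m(1)])
  next
    case False
    then have "m ((- r) *\<^sub>R (- x)) = (- r) * m (- x)"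
      by (intro sublinear_scaleR[OF m(1)]) simp
    then show ?thesis by (simp add: neg)
  qed
  then have "linear m" by (intro linearI) (auto simp: add)
  with m show ?thesis by blast
qed

text \<open>The choice of \<open>lower_along v norm\<close> as majorant encodes the norming
  condition: it lies below \<open>norm\<close>, and at \<open>- v\<close> the parameter
  \<open>1\<close> bounds it by \<open>- norm v\<close>, which forces
  \<open>f v \<ge> norm v\<close>.\<close>

lemma Hahn_Banach_norming_functional:
  fixes v :: "'a::real_normed_vector"
  shows "\<exists>f :: 'a \<Rightarrow> real. linear f \<and> (\<forall>x. \<bar>f x\<bar> \<le> norm x) \<and> f v = norm v"
proof -
  have n: "sublinear (norm :: 'a \<Rightarrow> real)"
    by (auto simp: sublinear_def norm_triangle_ineq)
  obtain f where f: "linear f" "f \<le> lower_along v norm"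
    using ex_linear_below_sublinear[OF sublinear_lower_along[OF n]] by blast
  have le: "f x \<le> norm x" for x
    using le_funD[OF f(2), of x] lower_along_le[OF n, of 0 v x] by simp
  have abs: "\<bar>f x\<bar> \<le> norm x" for x
    using le[of x] le[of "- x"] linear_neg[OF f(1), of x] by simp
  have "f (- v) \<le> - norm v"
    using le_funD[OF f(2), of "- v"] lower_along_le[OF n, of 1 v "- v"] by simp
  then have "f v = norm v"
    using le[of v] linear_neg[OF f(1), of v] by simp
  with f(1) abs show ?thesis by blast
qed

subsection \<open>Triangular sequences\<close>

text \<open>For real-linear \<open>f\<close> over the complex numbers this is the kernel of the
  complex functional with real part \<open>f\<close>. Quantifying over all scalars turns a real
  kernel into a subspace over \<open>'k\<close>.\<close>

definition kernel_over :: "('k \<Rightarrow> 'a \<Rightarrow> 'a) \<Rightarrow> ('a \<Rightarrow> real) \<Rightarrow> 'a set" where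
  "kernel_over smul f = {x. \<forall>c. f (smul c x) = 0}"

context banach_space_over
begin

section \<open>Continuity of scaling, closures and spans over the scalar field\<close>

lemma linear_smul_left: "linear (\<lambda>c. smul c x)"
proof (rule linearI)
  show "smul (r *\<^sub>R c) x = r *\<^sub>R smul c x" for r c
    by (simp add: scaleR_conv_of_real flip: scale_of_real)
qed (rule scale_left_distrib)

lemma bounded_linear_smul_right: "bounded_linear (smul c)"
proof (rule bounded_linear_intro)
  show "smul c (r *\<^sub>R x) = r *\<^sub>R smul c x" for r x
    by (simp add: mult.commute flip: scale_of_real)
  show "norm (smul c x) \<le> norm x * norm c" for x
    by (simp add: norm_scale mult.commute)
qed (rule scale_right_distrib)

lemma subspace_closure:
  assumes "subspace S"
  shows "subspace (closure S)"
proof (rule subspaceI)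
  show "0 \<in> closure S"
    using subspace_0[OF assms] closure_subset by blast
next
  fix x y
  assume "x \<in> closure S" "y \<in> closure S"
  then obtain u v where "\<And>n. u n \<in> S" "u \<longlonglongrightarrow> x" "\<And>n. v n \<in> S" "v \<longlonglongrightarrow> y"
    unfolding closure_sequential by blast
  then show "x + y \<in> closure S"
    unfolding closure_sequential
    by (intro exI[of _ "\<lambda>n. u n + v n"]) (auto intro: tendsto_add subspace_add[OF assms])
next
  fix c x
  assume "x \<in> closure S"
  then obtain u where "\<And>n. u n \<in> S" "u \<longlonglongrightarrow> x"
    unfolding closure_sequential by blast
  then show "smul c x \<in> closure S"
    unfolding closure_sequential
    by (intro exI[of _ "\<lambda>n. smul c (u n)"])
      (auto intro: bounded_linear.tendsto[OF bounded_linear_smul_right] subspace_scale[OF assms])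
qed

lemma span_range_sum:
  fixes z :: "nat \<Rightarrow> 'a"
  assumes "x \<in> span (range z)"
  shows "\<exists>a m. x = (\<Sum>i<m. smul (a i) (z i))"
  using assms
proof (induction rule: span_induct_alt)
  case base
  show ?case by (rule exI, rule exI[of _ 0]) simp
next
  case (step c x y)
  then obtain k a m where k: "x = z k" and y: "y = (\<Sum>i<m. smul (a i) (z i))" by blast
  \<comment> \<open>A common length for both sums; the coefficients are padded with zeros up to
    it.\<close>
  define n where "n = max m (Suc k)"
  have "y = (\<Sum>i<n. smul (if i < m then a i else 0) (z i))"
    unfolding y by (intro sum.mono_neutral_cong_left) (auto simp: n_def)
  moreover have "smul c x = (\<Sum>i<n. smul (if i = k then c else 0) (z i))"
  proof -
    have "(\<Sum>i<n. smul (if i = k then c else 0) (z i)) = (\<Sum>i<n. if i = k then smul c (z i) else 0)"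
      by (intro sum.cong) auto
    then show ?thesis by (simp add: k n_def less_max_iff_disj)
  qed
  ultimately have "smul c x + y =
      (\<Sum>i<n. smul ((if i = k then c else 0) + (if i < m then a i else 0)) (z i))"
    by (simp add: scale_left_distrib sum.distrib)
  then show ?case
    by (intro exI[of _ "\<lambda>i. (if i = k then c else 0) + (if i < m then a i else 0)"] exI[of _ n])
qed

section \<open>Subspaces cut out by real functionals\<close>

lemma closed_subspace_kernel_over:
  assumes f: "bounded_linear f"
  shows "closed_subspace smul (kernel_over smul f)"
proof -
  interpret f: bounded_linear f by (rule f)
  have "closed (\<Inter>c. {x. f (smul c x) = 0})"
    by (intro closed_INT ballI closed_Collect_eq continuous_intros
        f.continuous_on bounded_linear.continuous_on[OF bounded_linear_smul_right])
  moreover have "kernel_over smul f = (\<Inter>c. {x. f (smul c x) = 0})"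
    by (auto simp: kernel_over_def)
  moreover have "subspace (kernel_over smul f)"
    by (rule subspaceI) (simp_all add: kernel_over_def scale_right_distrib f.add f.zero)
  ultimately show ?thesis by (simp add: closed_subspace_def)
qed

text \<open>
  The map \<open>c \<mapsto> f (smul c z)\<close> ranges over the real dual of \<open>'k\<close>, which has the same real
  dimension as \<open>'k\<close>; hence the kernel has codimension at most one over \<open>'k\<close>.
\<close>

lemma infinite_dim_Int_kernel_over:
  assumes Z: "subspace Z" and inf: "infinite_dim smul Z" and f: "linear f"
  shows "infinite_dim smul (Z \<inter> kernel_over smul f)"
  unfolding infinite_dim_def
proof
  assume "\<exists>B. finite B \<and> Z \<inter> kernel_over smul f \<subseteq> span B"
  then obtain B where B: "finite B" "Z \<inter> kernel_over smul f \<subseteq> span B" by blast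
  then have "\<not> Z \<subseteq> kernel_over smul f"
    using inf by (auto simp: infinite_dim_def Int_absorb2)
  then obtain z c0 where z: "z \<in> Z" "f (smul c0 z) \<noteq> 0"
    by (auto simp: kernel_over_def)
  have lin: "linear (\<lambda>c. f (smul c x))" for x
    using linear_compose[OF linear_smul_left f, of x] by (simp add: o_def)
  \<comment> \<open>\<open>T a\<close> represents the real functional
    \<open>c \<mapsto> f (smul (c * a) z)\<close> on \<open>'k\<close> by its values on
    \<open>Basis\<close>.\<close>
  define T :: "'k \<Rightarrow> 'k" where "T a = (\<Sum>b\<in>Basis. f (smul (b * a) z) *\<^sub>R b)" for a
  have T_inner: "T a \<bullet> b = f (smul (b * a) z)" if "b \<in> Basis" for a b
    using that by (simp add: T_def inner_sum_left_Basis)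
  have linT: "linear T"
  proof (rule linearI)
    show "T (a + b) = T a + T b" for a b
      by (rule euclidean_eqI)
        (simp add: T_inner inner_add_left distrib_left linear_add[OF lin])
    show "T (r *\<^sub>R a) = r *\<^sub>R T a" for r a
      by (rule euclidean_eqI) (simp add: T_inner linear_cmul[OF lin])
  qed
  have eqI: "f (smul c x) = f (smul c y)" if "\<And>b. b \<in> Basis \<Longrightarrow> f (smul b x) = f (smul b y)" for x y c
    using fun_cong[OF linear_eq_stdbasis[OF lin lin that], of c] by simp
  have "inj T"
    unfolding linear_injective_0[OF linT]
  proof (intro allI impI)
    fix a assume a: "T a = 0"
    have "f (smul c (smul a z)) = f (smul c 0)" for c
      by (rule eqI) (simp add: T_inner[symmetric] a linear_0[OF f])
    \<comment> \<open>For \<open>a \<noteq> 0\<close> the product \<open>c0 / a * a\<close> is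
      \<open>c0\<close>, where the functional does not vanish.\<close>
    from this[of "c0 / a"] have "f (smul (c0 / a * a) z) = 0"
      by (simp add: linear_0[OF f])
    then show "a = 0"
      using z(2) by (cases "a = 0") simp_all
  qed
  then have surj: "surj T"
    by (rule linear_inj_imp_surj[OF linT])
  have "Z \<subseteq> span (insert z B)"
  proof
    fix x assume x: "x \<in> Z"
    \<comment> \<open>The scalar \<open>a\<close> makes \<open>smul a z\<close> and \<open>x\<close>
      indistinguishable by \<open>f\<close> under all scalars, so their difference falls into the
      kernel.\<close>
    obtain a where a: "T a = (\<Sum>b\<in>Basis. f (smul b x) *\<^sub>R b)"
      using surj by (metis surjD)
    have "f (smul c (smul a z)) = f (smul c x)" for c
      by (rule eqI) (simp add: T_inner[symmetric] a inner_sum_left_Basis)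
    then have "x - smul a z \<in> Z \<inter> kernel_over smul f"
      using x z(1) by (simp add: kernel_over_def scale_right_diff_distrib linear_diff[OF f]
          subspace_diff[OF Z] subspace_scale[OF Z] del: scale_scale)
    then show "x \<in> span (insert z B)"
      using B(2) span_breakdown_eq[of x z B] by blast
  qed
  then show False
    using inf B(1) by (auto simp: infinite_dim_def)
qed

text \<open>Applying \<open>f n\<close> removes all terms beyond \<open>n\<close>, so
  \<open>norm (a n)\<close> is at most the norm of the sum plus all earlier
  \<open>norm (a i)\<close>. The constants come from
  \<open>1 + (\<Sum>i<n. 2 ^ i) = 2 ^ n\<close>.\<close>

lemma norm_triangular_coefficient_le:
  assumes lin: "\<And>i. linear (f i)" and bd: "\<And>i x. \<bar>f i x\<bar> \<le> norm x"
    and one: "\<And>i. norm (z i) = 1" "\<And>i. f i (z i) = 1"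
    and ker: "\<And>i j. i < j \<Longrightarrow> z j \<in> kernel_over smul (f i)"
    and "n < m"
  shows "norm (a n) \<le> 2 ^ n * norm (\<Sum>i<m. smul (a i) (z i))"
  using \<open>n < m\<close>
proof (induction n rule: less_induct)
  case (less n)
  let ?x = "\<Sum>i<m. smul (a i) (z i)"
  \<comment> \<open>\<open>f n\<close> is only real-linear, so \<open>a n\<close> is first rotated
    to the real number \<open>norm (a n)\<close>. If \<open>a n = 0\<close>, division by zero makes
    \<open>c = 0\<close>, and both facts below still hold.\<close>
  define c where "c = of_real (norm (a n)) / a n"
  have c: "norm c \<le> 1" "c * a n = of_real (norm (a n))"
    by (auto simp: c_def norm_divide)
  have "f n (smul c ?x) = (\<Sum>i<m. f n (smul c (smul (a i) (z i))))"
    by (simp add: scale_sum_right linear_sum[OF lin])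
  also have "\<dots> = (\<Sum>i<Suc n. f n (smul c (smul (a i) (z i))))"
  proof (rule sum.mono_neutral_right)
    show "\<forall>i\<in>{..<m} - {..<Suc n}. f n (smul c (smul (a i) (z i))) = 0"
      using ker[of n] by (auto simp: kernel_over_def)
  qed (use less.prems in auto)
  also have "\<dots> = (\<Sum>i<n. f n (smul c (smul (a i) (z i)))) + norm (a n)"
    by (simp add: c(2) scale_of_real linear_cmul[OF lin] one)
  finally have "norm (a n) = f n (smul c ?x) - (\<Sum>i<n. f n (smul c (smul (a i) (z i))))"
    by simp
  also have "\<dots> \<le> \<bar>f n (smul c ?x)\<bar> + (\<Sum>i<n. \<bar>f n (smul c (smul (a i) (z i)))\<bar>)"
    using sum_abs[of "\<lambda>i. f n (smul c (smul (a i) (z i)))" "{..<n}"] by linarith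
  also have "\<dots> \<le> norm ?x + (\<Sum>i<n. 2 ^ i * norm ?x)"
  proof (intro add_mono sum_mono)
    show "\<bar>f n (smul c ?x)\<bar> \<le> norm ?x"
      using bd[of n "smul c ?x"] c(1) mult_right_mono[OF c(1), of "norm ?x"] by (simp add: norm_scale)
    fix i assume i: "i \<in> {..<n}"
    have "\<bar>f n (smul c (smul (a i) (z i)))\<bar> \<le> norm c * norm (a i)"
      using bd[of n "smul c (smul (a i) (z i))"] by (simp add: norm_scale norm_mult one)
    also have "\<dots> \<le> norm (a i)"
      using mult_right_mono[OF c(1), of "norm (a i)"] by simp
    also have "\<dots> \<le> 2 ^ i * norm ?x"
      using less.IH[of i] less.prems i by simp
    finally show "\<bar>f n (smul c (smul (a i) (z i)))\<bar> \<le> 2 ^ i * norm ?x" .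
  qed
  also have "\<dots> = 2 ^ n * norm ?x"
  proof -
    have "(\<Sum>i<n. 2 ^ i) = (2 ^ n - 1 :: real)"
      by (induction n) auto
    then show ?thesis by (simp flip: sum_distrib_right) (simp add: algebra_simps)
  qed
  finally show ?case .
qed

section \<open>Construction of the triangular sequence\<close>

lemma strictly_singular_pair_unit_vector:
  assumes ss: "strictly_singular_pair smul M N" and N: "closed_subspace smul N"
    and Z: "closed_subspace smul Z" "Z \<subseteq> M" "infinite_dim smul Z" and "\<epsilon> > 0"
  obtains z y where "z \<in> Z" "norm z = 1" "y \<in> N" "norm (z - y) \<le> \<epsilon>"
proof -
  have subN: "subspace N" and subZ: "subspace Z"
    using N Z by (auto simp: closed_subspace_def)
  obtain z where z: "z \<in> Z" "quotient_norm (quotient_map N z) < \<epsilon> * norm z"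
    using ss Z \<open>\<epsilon> > 0\<close> unfolding strictly_singular_pair_def strictly_singular_def by blast
  have ne: "norm ` quotient_map N z \<noteq> {}"
    using subspace_0[OF subN] by (auto simp: quotient_map_def)
  obtain w where w: "w \<in> N" "norm (z + w) < \<epsilon> * norm z"
    using cInf_lessD[OF ne] z(2) by (auto simp: quotient_norm_def quotient_map_def)
  \<comment> \<open>The strictness of the inequality excludes \<open>z = 0\<close>, which permits
    normalisation.\<close>
  have "0 < \<epsilon> * norm z"
    using w(2) norm_ge_zero[of "z + w"] by linarith
  then have pos: "norm z > 0" using \<open>\<epsilon> > 0\<close> by (simp add: zero_less_mult_iff)
  define r :: 'k where "r = of_real (inverse (norm z))"
  have r: "norm r = inverse (norm z)" by (simp add: r_def norm_inverse)
  show ?thesis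
  proof
    show "smul r z \<in> Z" using z(1) subspace_scale[OF subZ] by blast
    show "norm (smul r z) = 1" using pos by (simp add: norm_scale r)
    show "smul r (- w) \<in> N" using w(1) subspace_scale[OF subN] subspace_neg[OF subN] by blast
    have "smul r z - smul r (- w) = smul r (z + w)"
      by (simp add: scale_right_distrib)
    then have "norm (smul r z - smul r (- w)) = norm (z + w) / norm z"
      by (simp only: norm_scale r divide_inverse_commute)
    then show "norm (smul r z - smul r (- w)) \<le> \<epsilon>"
      using w(2) pos by (simp only: pos_divide_le_eq)
  qed
qed

text \<open>Intersecting with \<open>kernel_over smul (f n)\<close> keeps the current subspace
  closed and infinite-dimensional, so strict singularity can be applied again inside it.\<close>

lemma strictly_singular_pair_triangular_sequence:
  assumes ss: "strictly_singular_pair smul M N" and N: "closed_subspace smul N"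
    and K: "closed_subspace smul K" "K \<subseteq> M" "infinite_dim smul K" and \<delta>: "\<And>n::nat. \<delta> n > 0"
  obtains z y f where "\<And>n. z n \<in> K" "\<And>n. norm (z n) = 1" "\<And>n. y n \<in> N"
    "\<And>n. norm (z n - y n) \<le> \<delta> n" "\<And>n. linear (f n :: 'a \<Rightarrow> real)"
    "\<And>n x. \<bar>f n x\<bar> \<le> norm x" "\<And>n. f n (z n) = 1"
    "\<And>i j. i < j \<Longrightarrow> z j \<in> kernel_over smul (f i)"
proof -
  \<comment> \<open>The state of the recursion: current subspace, unit vector in it, approximation
    in \<open>N\<close>, norming functional.\<close>
  define P where "P n = (\<lambda>(V, z, y, f :: 'a \<Rightarrow> real).
      closed_subspace smul V \<and> V \<subseteq> K \<and> infinite_dim smul V \<and> z \<in> V \<and> norm z = 1 \<and> y \<in> N \<and>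
      norm (z - y) \<le> \<delta> n \<and> linear f \<and> (\<forall>x. \<bar>f x\<bar> \<le> norm x) \<and> f z = 1)" for n
  have ex: "\<exists>s. P n s \<and> fst s = V"
    if V: "closed_subspace smul V" "V \<subseteq> K" "infinite_dim smul V" for n V
  proof -
    obtain z y where zy: "z \<in> V" "norm z = 1" "y \<in> N" "norm (z - y) \<le> \<delta> n"
      using strictly_singular_pair_unit_vector[OF ss N V(1) _ V(3) \<delta>] V(2) K(2) by blast
    obtain f :: "'a \<Rightarrow> real" where "linear f" "\<forall>x. \<bar>f x\<bar> \<le> norm x" "f z = norm z"
      using Hahn_Banach_norming_functional by blast
    then show ?thesis
      using V zy by (intro exI[of _ "(V, z, y, f)"]) (simp add: P_def)
  qed
  have "\<exists>s. \<forall>n. P n (s n) \<and> fst (s (Suc n)) = fst (s n) \<inter> kernel_over smul (snd (snd (snd (s n))))"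
  proof (rule dependent_nat_choice)
    show "\<exists>s. P 0 s" using ex[OF K(1) _ K(3)] by blast
  next
    fix s n assume s: "P n s"
    obtain V z y f where [simp]: "s = (V, z, y, f)" by (cases s)
    have f: "linear f" "\<And>x. \<bar>f x\<bar> \<le> norm x" and V: "closed_subspace smul V" "V \<subseteq> K" "infinite_dim smul V"
      using s by (auto simp: P_def)
    have "bounded_linear f"
      using f by (auto intro!: bounded_linear_intro[where K = 1] simp: linear_add linear_cmul)
    then have "closed_subspace smul (V \<inter> kernel_over smul f)"
      using V(1) closed_subspace_kernel_over[of f]
      by (auto simp: closed_subspace_def intro: subspace_inter)
    moreover have "infinite_dim smul (V \<inter> kernel_over smul f)"
      using V f(1) by (intro infinite_dim_Int_kernel_over) (auto simp: closed_subspace_def)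
    ultimately show "\<exists>s'. P (Suc n) s' \<and> fst s' = fst s \<inter> kernel_over smul (snd (snd (snd s)))"
      using ex V(2) by (simp add: le_infI1)
  qed
  then obtain s where s: "\<And>n. P n (s n)"
    and step: "\<And>n. fst (s (Suc n)) = fst (s n) \<inter> kernel_over smul (snd (snd (snd (s n))))"
    by metis
  define V where "V n = fst (s n)" for n
  define z where "z n = fst (snd (s n))" for n
  define y where "y n = fst (snd (snd (s n)))" for n
  define f where "f n = snd (snd (snd (s n)))" for n
  have props: "V n \<subseteq> K" "z n \<in> V n" "norm (z n) = 1" "y n \<in> N" "norm (z n - y n) \<le> \<delta> n"
    "linear (f n)" "\<bar>f n x\<bar> \<le> norm x" "f n (z n) = 1" for n x
    using s[of n] by (auto simp: P_def V_def z_def y_def f_def split: prod.splits)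
  have step: "V (Suc n) = V n \<inter> kernel_over smul (f n)" for n
    using step by (simp add: V_def f_def)
  have anti: "V j \<subseteq> V i" if "i \<le> j" for i j
    by (rule lift_Suc_antimono_le[OF _ that]) (simp add: step)
  \<comment> \<open>The subspaces decrease, so \<open>z j\<close> lies in \<open>V (Suc i)\<close>,
    which was cut down by the kernel of \<open>f i\<close>.\<close>
  have ker: "z j \<in> kernel_over smul (f i)" if "i < j" for i j
    using subsetD[OF anti[OF Suc_leI[OF that]] props(2)] by (simp add: step)
  show ?thesis
  proof (rule that[of z y f])
    show "z n \<in> K" for n using props(1,2) by blast
    show "norm (z n) = 1" for n by (rule props)
    show "y n \<in> N" for n by (rule props)
    show "norm (z n - y n) \<le> \<delta> n" for n by (rule props)
    show "linear (f n)" for n by (rule props)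
    show "\<bar>f n x\<bar> \<le> norm x" for n x by (rule props)
    show "f n (z n) = 1" for n by (rule props)
    show "z j \<in> kernel_over smul (f i)" if "i < j" for i j using that by (rule ker)
  qed
qed

section \<open>The closed span of a triangular sequence\<close>

lemma triangular_infinite_dim:
  fixes z :: "nat \<Rightarrow> 'a"
  assumes lin: "\<And>i. linear (f i)" and bd: "\<And>i x. \<bar>f i x\<bar> \<le> norm x"
    and one: "\<And>i. norm (z i) = 1" "\<And>i. f i (z i) = 1"
    and ker: "\<And>i j. i < j \<Longrightarrow> z j \<in> kernel_over smul (f i)"
    and "range z \<subseteq> S"
  shows "infinite_dim smul S"
  unfolding infinite_dim_def
proof
  assume "\<exists>B. finite B \<and> S \<subseteq> span B"
  then obtain B where B: "finite B" "range z \<subseteq> span B"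
    using \<open>range z \<subseteq> S\<close> by (meson subset_trans)
  \<comment> \<open>\<open>f i\<close> takes the value 1 at \<open>z i\<close> and 0 at
    \<open>z j\<close>. Injectivity is what lets sums and cardinalities over \<open>A\<close> be
    read off the indices.\<close>
  have ne: "z i \<noteq> z j" if "i < j" for i j
  proof
    assume eq: "z i = z j"
    have "f i (smul 1 (z j)) = 0" using ker[OF that] unfolding kernel_over_def by blast
    then show False by (simp add: one flip: eq)
  qed
  have inj: "inj z"
    by (rule linorder_injI) (rule ne)
  \<comment> \<open>One vector more than \<open>B\<close> has: the coefficient bound turns a
    vanishing combination into vanishing coefficients, so \<open>A\<close> is independent and too
    large for \<open>span B\<close>.\<close>
  define A where "A = z ` {..<Suc (card B)}"
  have "independent A"
  proof (rule independent_if_scalars_zero)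
    fix g x
    assume "(\<Sum>x\<in>A. smul (g x) x) = 0" "x \<in> A"
    then have 0: "(\<Sum>i<Suc (card B). smul (g (z i)) (z i)) = 0"
      by (simp add: A_def sum.reindex[OF inj_on_subset[OF inj]] o_def del: sum.lessThan_Suc)
    obtain n where n: "n < Suc (card B)" "x = z n" using \<open>x \<in> A\<close> by (auto simp: A_def)
    have "norm (g (z n)) \<le> 2 ^ n * norm (\<Sum>i<Suc (card B). smul (g (z i)) (z i))"
      by (rule norm_triangular_coefficient_le[where f = f, OF lin bd one _ n(1)]) (rule ker)
    then show "g x = 0"
      unfolding 0 by (simp add: n(2))
  qed (simp add: A_def)
  then have "card A \<le> card B"
    using independent_span_bound[OF B(1)] B(2) by (auto simp: A_def)
  then show False
    by (simp add: A_def card_image[OF inj_on_subset[OF inj]])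
qed

text \<open>Closeness to \<open>N\<close> is expressed by \<open>infdist\<close>, not by
  approximating vectors, because it is continuous and the estimate passes from the span to its
  closure.\<close>

lemma strictly_singular_pair_small_subspace:
  assumes ss: "strictly_singular_pair smul M N" and N: "closed_subspace smul N"
    and K: "closed_subspace smul K" "K \<subseteq> M" "infinite_dim smul K" and "\<epsilon> > 0"
  shows "\<exists>L. closed_subspace smul L \<and> L \<subseteq> K \<and> infinite_dim smul L \<and>
    (\<forall>x\<in>L. infdist x N \<le> \<epsilon> * norm x)"
proof -
  \<comment> \<open>Chosen against the growth \<open>2 ^ n\<close> of the coefficient bounds:
    \<open>2 ^ n * \<delta> n = \<epsilon> * (1 / 2) ^ (n + 1)\<close>, with partial sums below
    \<open>\<epsilon>\<close>.\<close>
  define \<delta> :: "nat \<Rightarrow> real" where "\<delta> n = \<epsilon> * (1 / 4) ^ n / 2" for n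
  have \<delta>: "\<delta> n > 0" for n using \<open>\<epsilon> > 0\<close> by (simp add: \<delta>_def)
  have \<delta>_sum: "(\<Sum>i<m. 2 ^ i * \<delta> i) \<le> \<epsilon>" for m
  proof -
    have "2 ^ i * (1 / 4) ^ i = (1 / 2 :: real) ^ i" for i
      by (simp flip: power_mult_distrib)
    then have "(\<Sum>i<m. 2 ^ i * \<delta> i) = \<epsilon> * ((\<Sum>i<m. (1 / 2) ^ i) / 2)"
      by (simp add: \<delta>_def sum_distrib_left sum_divide_distrib mult.left_commute)
    also have "(\<Sum>i<m. (1 / 2) ^ i) / 2 = 1 - (1 / 2 :: real) ^ m"
      by (induction m) (auto simp: field_simps)
    also have "\<epsilon> * (1 - (1 / 2) ^ m) \<le> \<epsilon> * 1"
      using \<open>\<epsilon> > 0\<close> by (intro mult_left_mono) auto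
    finally show ?thesis by simp
  qed
  have subN: "subspace N" and subK: "subspace K"
    using N K by (auto simp: closed_subspace_def)
  obtain z y and f :: "nat \<Rightarrow> 'a \<Rightarrow> real" where zK: "\<And>n. z n \<in> K"
    and z1: "\<And>n. norm (z n) = 1" and y: "\<And>n. y n \<in> N"
    and zy: "\<And>n. norm (z n - y n) \<le> \<delta> n" and lin: "\<And>n. linear (f n)"
    and bd: "\<And>n x. \<bar>f n x\<bar> \<le> norm x" and fz: "\<And>n. f n (z n) = 1"
    and ker: "\<And>i j. i < j \<Longrightarrow> z j \<in> kernel_over smul (f i)"
    by (rule strictly_singular_pair_triangular_sequence[OF ss N K, of \<delta>]) (use \<delta> in blast)+
  define S where "S = span (range z)"
  have "S \<subseteq> K"
    unfolding S_def using zK by (intro span_minimal subK) auto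
  have "infdist x N \<le> \<epsilon> * norm x" if xS: "x \<in> S" for x
  proof -
    obtain a m where x: "x = (\<Sum>i<m. smul (a i) (z i))"
      using xS span_range_sum[of x z] by (auto simp: S_def)
    define w where "w = (\<Sum>i<m. smul (a i) (y i))"
    have "w \<in> N"
      using y by (auto simp: w_def intro!: subspace_sum[OF subN] subspace_scale[OF subN])
    then have "infdist x N \<le> norm (x - w)"
      using infdist_le[of w N x] by (simp add: dist_norm)
    also have "\<dots> = norm (\<Sum>i<m. smul (a i) (z i - y i))"
      by (simp add: x w_def scale_right_diff_distrib sum_subtractf)
    also have "\<dots> \<le> (\<Sum>i<m. norm (a i) * norm (z i - y i))"
      by (rule sum_norm_le) (simp add: norm_scale)
    also have "\<dots> \<le> (\<Sum>i<m. (2 ^ i * norm x) * \<delta> i)"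
    proof (intro sum_mono mult_mono)
      fix i assume "i \<in> {..<m}"
      then have "i < m" by simp
      then show "norm (a i) \<le> 2 ^ i * norm x"
        unfolding x
        by (rule norm_triangular_coefficient_le[where f = f, OF lin bd z1 fz, rotated]) (rule ker)
    qed (use zy in auto)
    also have "\<dots> = (\<Sum>i<m. 2 ^ i * \<delta> i) * norm x"
      by (simp add: sum_distrib_left mult_ac)
    also have "\<dots> \<le> \<epsilon> * norm x"
      using \<delta>_sum by (intro mult_right_mono) auto
    finally show ?thesis .
  qed
  then have "S \<subseteq> {x. infdist x N \<le> \<epsilon> * norm x}" by blast
  moreover have "closed {x. infdist x N \<le> \<epsilon> * norm x}"
    by (intro closed_Collect_le continuous_intros)
  ultimately have "closure S \<subseteq> {x. infdist x N \<le> \<epsilon> * norm x}"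
    by (rule closure_minimal)
  moreover have "closure S \<subseteq> K"
    using \<open>S \<subseteq> K\<close> K(1) by (intro closure_minimal) (auto simp: closed_subspace_def)
  moreover have "infinite_dim smul (closure S)"
  proof (rule triangular_infinite_dim[where f = f, OF lin bd z1 fz])
    show "range z \<subseteq> closure S"
      using span_superset closure_subset unfolding S_def by (rule subset_trans)
  qed (rule ker)
  moreover have "closed_subspace smul (closure S)"
    using subspace_closure[OF subspace_span] by (simp add: closed_subspace_def S_def)
  ultimately show ?thesis by blast
qed

end

section \<open>Vanishing of the strictly singular adjustment\<close>

theorem lemma3p4p5:
  fixes smul :: "'k::{real_normed_field,euclidean_space} \<Rightarrow> 'a::banach \<Rightarrow> 'a"
    and M N :: "'a set" and I :: "nat set"
  assumes "banach_space_over smul"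
    and "closed_subspace smul M" and "closed_subspace smul N"
    and "M \<noteq> {0}"
    and "strictly_singular_pair smul M N"
    and "infinite I"
  shows "SS_uniform_adjustment smul I (\<lambda>n. M) (\<lambda>n. N) = 0"
proof -
  interpret banach_space_over smul by fact
  have neN: "N \<noteq> {}"
    using assms(3) subspace_0[of N] by (auto simp: closed_subspace_def)
  \<comment> \<open>This makes 0 an admissible value. The witness for \<open>H\<close> is
    \<open>J\<close> itself: only the subspaces shrink.\<close>
  have main: "\<exists>H L. H \<subseteq> J \<and> infinite H \<and>
      (\<forall>n\<in>H. closed_subspace smul (L n) \<and> L n \<subseteq> K n \<and> infinite_dim smul (L n)) \<and>
      uniform_adjustment H L (\<lambda>n. N) \<le> 0"
    if J: "infinite J" and K: "\<forall>n\<in>J. closed_subspace smul (K n) \<and> K n \<subseteq> M \<and> infinite_dim smul (K n)"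
    for J K
  proof -
    define e :: "nat \<Rightarrow> real" where "e n = inverse (real (Suc n))" for n
    have "\<forall>n\<in>J. \<exists>L. closed_subspace smul L \<and> L \<subseteq> K n \<and> infinite_dim smul L \<and>
        (\<forall>x\<in>L. infdist x N \<le> e n * norm x)"
      using K by (intro ballI strictly_singular_pair_small_subspace[OF assms(5,3)]) (auto simp: e_def)
    then obtain L where L: "\<forall>n\<in>J. closed_subspace smul (L n) \<and> L n \<subseteq> K n \<and> infinite_dim smul (L n) \<and>
        (\<forall>x\<in>L n. infdist x N \<le> e n * norm x)"
      by metis
    have "lower_uniformly_adjusted J L (\<lambda>n. N) 0"
      unfolding lower_uniformly_adjusted_def
    proof (intro allI impI, elim conjE)
      fix \<eta> :: real and J' x
      assume \<eta>: "\<eta> > 0" and J': "J' \<subseteq> J" "infinite J'" and x: "\<forall>n\<in>J'. x n \<in> L n \<and> norm (x n) = 1"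
      \<comment> \<open>The distance to \<open>N\<close> may not be attained; the factor 2 gives the
        strict margin that produces an actual \<open>y\<close>.\<close>
      have "\<exists>y\<in>N. norm (x n - y) < 2 * e n" if "n \<in> J'" for n
      proof -
        have "infdist (x n) N < 2 * e n"
          using L x J' that by (force simp: e_def intro: le_less_trans[of _ "e n"])
        then show ?thesis
          using cInf_lessD[of "dist (x n) ` N" "2 * e n"] neN by (auto simp: infdist_def dist_norm)
      qed
      then obtain y where y: "\<forall>n\<in>J'. y n \<in> N \<and> norm (x n - y n) < 2 * e n"
        by metis
      have "(\<lambda>n. 2 * e n) \<longlonglongrightarrow> 2 * 0"
        unfolding e_def by (intro tendsto_mult tendsto_const LIMSEQ_inverse_real_of_nat)
      then have "\<forall>\<^sub>F n in sequentially. 2 * e n < \<eta>"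
        by (rule order_tendstoD(2)) (use \<eta> in simp)
      then have "\<forall>\<^sub>F n in inf sequentially (principal J'). ereal (norm (x n - y n - 0)) \<le> ereal (0 + \<eta>)"
        unfolding eventually_inf_principal by eventually_elim (use y in force)
      then have "Limsup (inf sequentially (principal J')) (\<lambda>n. ereal (norm (x n - y n - 0))) \<le> ereal (0 + \<eta>)"
        by (rule Limsup_bounded)
      then show "\<exists>K y z. K \<subseteq> J' \<and> infinite K \<and> (\<forall>n\<in>K. y n \<in> N) \<and>
          Limsup (inf sequentially (principal K)) (\<lambda>n. ereal (norm (x n - y n - z))) \<le> ereal (0 + \<eta>)"
        using J' y by blast
    qed
    then have "uniform_adjustment J L (\<lambda>n. N) \<le> 0"
      unfolding uniform_adjustment_def by (intro cInf_lower bdd_belowI[of _ 0]) auto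
    with L J show ?thesis by blast
  qed
  show ?thesis
    unfolding SS_uniform_adjustment_def
    by (rule cInf_eq_minimum) (use main in auto)
qed

end
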